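(* Let $g_n$ be the total number of rows in all truth tables for bracketed implication with $n$ distinct variables $p_1,\ldots,p_n$. Then $g_1=2$ and for all $n\ge 2$ $$g_n=\sum_{i=1}^{n-1} g_i g_{n-i}.$$
   Context: A bracketed implication with $n$ distinct variables is a well-formed formula obtained from $p_1\to p_2\to\cdots\to p_n$ (variables in this fixed order) by fully inserting brackets; for $n=1$ it is the single formula $p_1$. Each such formula has its own truth table, with one row for each of the $2^n$ valuations of $p_1,\dots,p_n$ in $\{\text{false},\text{true}\}$. *)

theory Defs
  imports Main "HOL-Library.FuncSet"
begin

text \<open>The propositional variables are indexed by natural numbers: \<open>Var i\<close> is $p_i$.\<close>

datatype form = Var nat | Imp form form

primrec eval :: "(nat \<Rightarrow> bool) \<Rightarrow> form \<Rightarrow> bool" where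
  "eval v (Var i) = v i"
| "eval v (Imp \<phi> \<psi>) = (eval v \<phi> \<longrightarrow> eval v \<psi>)"

primrec var_list :: "form \<Rightarrow> nat list" where
  "var_list (Var i) = [i]"
| "var_list (Imp \<phi> \<psi>) = var_list \<phi> @ var_list \<psi>"

text \<open>
  A formula is a full bracketing of $p_1 \to p_2 \to \cdots \to p_n$ exactly when erasing its
  brackets leaves that string, i.e. when its variables, read from left to right with repetitions,
  are $p_1, \ldots, p_n$. For \<open>n = 0\<close> there is no such formula.
\<close>

definition bracketed_implications :: "nat \<Rightarrow> form set" where
  "bracketed_implications n = {\<phi>. var_list \<phi> = [1..<Suc n]}"

text \<open>
  A row of the truth table of \<open>\<phi>\<close> is a valuation of the variables of \<open>\<phi>\<close> together with the
  resulting truth value. Valuations are extensional functions, so that two of them which agree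
  on the variables of \<open>\<phi>\<close> give the same row.
\<close>

definition truth_table :: "form \<Rightarrow> ((nat \<Rightarrow> bool) \<times> bool) set" where
  "truth_table \<phi> = (\<lambda>v. (v, eval v \<phi>)) ` (set (var_list \<phi>) \<rightarrow>\<^sub>E UNIV)"

definition total_rows :: "nat \<Rightarrow> nat" where
  "total_rows n = (\<Sum>\<phi>\<in>bracketed_implications n. card (truth_table \<phi>))"

text \<open>
  Neither the sum nor the cardinalities above are the default value for an infinite set.
\<close>

lemma finite_var_list_eq: "finite {\<phi>. var_list \<phi> = xs}"
proof (induction "length xs" arbitrary: xs rule: less_induct)
  case less
  have ne: "var_list \<phi> \<noteq> []" for \<phi>
    by (induction \<phi>) auto
  let ?S = "\<Union>k\<in>{1..<length xs}.
    (\<lambda>(\<phi>, \<psi>). Imp \<phi> \<psi>) ` ({\<phi>. var_list \<phi> = take k xs} \<times> {\<psi>. var_list \<psi> = drop k xs})"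
  have "finite ?S"
    using less by auto
  moreover have "{\<phi>. var_list \<phi> = xs} \<subseteq> Var ` set xs \<union> ?S"
  proof
    fix \<phi> assume "\<phi> \<in> {\<phi>. var_list \<phi> = xs}"
    then have xs: "xs = var_list \<phi>" by simp
    show "\<phi> \<in> Var ` set xs \<union> ?S"
    proof (cases \<phi>)
      case (Var i)
      then show ?thesis using xs by simp
    next
      case (Imp a b)
      have "length (var_list a) \<in> {1..<length xs}"
        using ne[of a] ne[of b] xs Imp by (cases "var_list a") auto
      moreover have "var_list a = take (length (var_list a)) xs"
        "var_list b = drop (length (var_list a)) xs"
        using xs Imp by auto
      ultimately show ?thesis using Imp by blast
    qed
  qed
  ultimately show ?case
    by (meson finite_Un finite_imageI finite_set finite_subset)
qed

lemma finite_bracketed_implications: "finite (bracketed_implications n)"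
  unfolding bracketed_implications_def by (rule finite_var_list_eq)

lemma card_truth_table:
  assumes "\<phi> \<in> bracketed_implications n"
  shows "card (truth_table \<phi>) = 2 ^ n"
proof -
  have "card (truth_table \<phi>) = card (set (var_list \<phi>) \<rightarrow>\<^sub>E (UNIV :: bool set))"
    unfolding truth_table_def by (intro card_image inj_onI) auto
  also have "\<dots> = 2 ^ n"
    using assms by (simp add: bracketed_implications_def card_PiE del: upt_Suc)
  finally show ?thesis .
qed

end

theory Submission
  imports Defs
begin

text \<open>
  A bracketing of a word of length at least two splits uniquely at its main implication into
  bracketings of a nonempty prefix and of the complementary suffix. The number of bracketings of a
  word depends only on its length, so these numbers satisfy the Catalan recurrence; the factor
  $2^n = 2^i \, 2^{n-i}$ distributes over it.
\<close>

lemma var_list_nonempty: "var_list \<phi> \<noteq> []"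
  by (induction \<phi>) auto

lemma var_list_eq_singleton: "{\<phi>. var_list \<phi> = [x]} = {Var x}"
proof -
  have "\<phi> = Var x" if "var_list \<phi> = [x]" for \<phi>
    using that by (cases \<phi>) (auto simp: append_eq_Cons_conv var_list_nonempty)
  then show ?thesis by auto
qed

text \<open>The cut \<open>k\<close> is the number of leaves of the left subformula. Since
  \<open>var_list\<close> is never empty, both sides have a leaf, so \<open>k\<close> lies strictly
  inside the word; length at least 2 excludes \<open>Var\<close>.\<close>

lemma var_list_eq_split:
  assumes "length xs \<ge> 2"
  shows "{\<phi>. var_list \<phi> = xs} = (\<Union>k\<in>{1..length xs - 1}.
    (\<lambda>(\<phi>, \<psi>). Imp \<phi> \<psi>) ` ({\<phi>. var_list \<phi> = take k xs} \<times> {\<psi>. var_list \<psi> = drop k xs}))"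
    (is "?L = ?R")
proof
  show "?L \<subseteq> ?R"
  proof
    fix \<chi> assume "\<chi> \<in> ?L"
    then have xs: "xs = var_list \<chi>" by simp
    with assms obtain \<phi> \<psi> where Imp: "\<chi> = Imp \<phi> \<psi>" by (cases \<chi>) auto
    have "length (var_list \<phi>) \<in> {1..length xs - 1}"
      using var_list_nonempty[of \<phi>] var_list_nonempty[of \<psi>] xs Imp
      by (cases "var_list \<phi>"; cases "var_list \<psi>") auto
    moreover have "var_list \<phi> = take (length (var_list \<phi>)) xs"
      "var_list \<psi> = drop (length (var_list \<phi>)) xs"
      using xs Imp by auto
    ultimately show "\<chi> \<in> ?R" using Imp by blast
  qed
qed auto

lemma card_var_list_eq_split:
  assumes "length xs \<ge> 2"
  shows "card {\<phi>. var_list \<phi> = xs} = (\<Sum>k=1..length xs - 1.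
    card {\<phi>. var_list \<phi> = take k xs} * card {\<psi>. var_list \<psi> = drop k xs})"
proof -
  let ?S = "\<lambda>k. {\<phi>. var_list \<phi> = take k xs} \<times> {\<psi>. var_list \<psi> = drop k xs}"
  let ?I = "\<lambda>k. (\<lambda>(\<phi>, \<psi>). Imp \<phi> \<psi>) ` ?S k"
  have "?I i \<inter> ?I j = {}" if "i \<in> {1..length xs - 1}" "j \<in> {1..length xs - 1}" "i \<noteq> j" for i j
  proof -
    \<comment> \<open>Both indices are below \<open>length xs\<close>, so these prefixes really have
      lengths \<open>i\<close> and \<open>j\<close>; the left subformula thus determines the
      cut.\<close>
    have "length (take i xs) \<noteq> length (take j xs)" using that by auto
    then have "take i xs \<noteq> take j xs" by metis
    then show ?thesis by auto
  qed
  then have "card (\<Union>k\<in>{1..length xs - 1}. ?I k) = (\<Sum>k=1..length xs - 1. card (?I k))"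
    by (intro card_UN_disjoint) (auto simp: finite_var_list_eq)
  also have "\<dots> = (\<Sum>k=1..length xs - 1. card (?S k))"
    by (intro sum.cong refl card_image inj_onI) auto
  finally show ?thesis
    by (simp add: var_list_eq_split[OF assms] card_cartesian_product)
qed

text \<open>Needed because a suffix such as \<open>drop k xs\<close> of the standard word does not
  start at index 1, so its bracketings are not themselves a set
  \<open>bracketed_implications m\<close>. Strong induction on the length, through the split at the
  main implication.\<close>

lemma card_var_list_eq_cong:
  assumes "length xs = length ys"
  shows "card {\<phi>. var_list \<phi> = xs} = card {\<phi>. var_list \<phi> = ys}"
  using assms
proof (induction "length xs" arbitrary: xs ys rule: less_induct)
  case less
  \<comment> \<open>The rule \<open>remdups_adj.cases\<close> serves only as a case split into
    empty, singleton and longer lists.\<close>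
  consider "xs = []" | x where "xs = [x]" | "length xs \<ge> 2"
    by (cases xs rule: remdups_adj.cases) auto
  then show ?case
  proof cases
    case 1
    with less.prems show ?thesis by simp
  next
    case 2
    with less.prems show ?thesis
      by (cases ys) (auto simp: var_list_eq_singleton)
  next
    case 3
    have "card {\<phi>. var_list \<phi> = take k xs} = card {\<phi>. var_list \<phi> = take k ys}"
         "card {\<phi>. var_list \<phi> = drop k xs} = card {\<phi>. var_list \<phi> = drop k ys}"
      if "k \<in> {1..length xs - 1}" for k
      \<comment> \<open>For such \<open>k\<close> both pieces are strictly shorter than
        \<open>xs\<close>, as the induction hypothesis requires.\<close>
      using that 3 less.prems by (auto intro!: less.hyps)
    then show ?thesis
      using 3 less.prems by (simp add: card_var_list_eq_split)
  qed
qed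

text \<open>Leaving the word \<open>xs\<close> free lets \<open>total_rows\<close> be read off from
  any prefix or suffix of a single word.\<close>

lemma total_rows_eq:
  assumes "length xs = n"
  shows "total_rows n = 2 ^ n * card {\<phi>. var_list \<phi> = xs}"
proof -
  have "total_rows n = 2 ^ n * card (bracketed_implications n)"
    by (simp add: total_rows_def card_truth_table)
  then show ?thesis
    using card_var_list_eq_cong[of xs "[1..<Suc n]"] assms
    by (simp add: bracketed_implications_def del: upt_Suc)
qed

theorem proposition2p1:
  shows "total_rows 1 = 2 \<and>
    (\<forall>n\<ge>2. total_rows n = (\<Sum>i=1..n-1. total_rows i * total_rows (n - i)))"
proof (intro conjI allI impI)
  show "total_rows 1 = 2"
    using total_rows_eq[of "[0]" 1] by (simp add: var_list_eq_singleton)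
next
  fix n :: nat assume n: "n \<ge> 2"
  \<comment> \<open>Only the length of \<open>xs\<close> matters; its prefixes and suffixes supply
    words of lengths \<open>i\<close> and \<open>n - i\<close>.\<close>
  define xs where "xs = [0..<n]"
  have len: "length xs = n" by (simp add: xs_def)
  have "total_rows n = (\<Sum>i=1..n-1.
      2 ^ n * (card {\<phi>. var_list \<phi> = take i xs} * card {\<phi>. var_list \<phi> = drop i xs}))"
    using n len by (simp add: total_rows_eq[of xs] card_var_list_eq_split sum_distrib_left)
  also have "\<dots> = (\<Sum>i=1..n-1. total_rows i * total_rows (n - i))"
  proof (rule sum.cong[OF refl])
    fix i assume i: "i \<in> {1..n-1}"
    then have "i + (n - i) = n" by auto
    then have "(2::nat) ^ n = 2 ^ i * 2 ^ (n - i)"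
      by (metis power_add)
    moreover have "total_rows i = 2 ^ i * card {\<phi>. var_list \<phi> = take i xs}"
      using i len by (intro total_rows_eq) auto
    moreover have "total_rows (n - i) = 2 ^ (n - i) * card {\<phi>. var_list \<phi> = drop i xs}"
      using len by (intro total_rows_eq) auto
    ultimately show "2 ^ n * (card {\<phi>. var_list \<phi> = take i xs} * card {\<phi>. var_list \<phi> = drop i xs})
        = total_rows i * total_rows (n - i)"
      by simp
  qed
  finally show "total_rows n = (\<Sum>i=1..n-1. total_rows i * total_rows (n - i))" .
qed

end
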